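(* The following equalities hold: (1) $\Delta_2(\ker\Delta_1\cap\ker\Delta_0)=\Delta_1(\ker\Delta_0)=\Delta_0(\mathcal C)$; (2) $\langle\Delta_2,\Delta_1\rangle(\ker\Delta_0)=\langle\Delta_1,\Delta_0\rangle(\mathcal C)$; (3) $\Delta_1(\ker\Delta_0\cap\ker\Delta_2)=\Delta_0(\ker\Delta_1)$.
   Context: All spaces are complex. For the couple $(X_0,X_1)=(\ell_\infty,\ell_1)$ put $\Sigma=\ell_\infty+\ell_1$. The Calderón space $\mathcal C$ of the couple is the Banach space of bounded continuous functions $F:\{z\in\mathbb C:0\le \mathrm{Re}\,z\le 1\}\to\Sigma$, analytic on the open strip, such that for $j=0,1$ the map $t\mapsto F(j+it)$ is continuous from $\mathbb R$ into $X_j$ and tends to $0$ as $|t|\to\infty$, with norm $\|F\|=\max_{j=0,1}\sup_{t}\|F(j+it)\|_{X_j}$. For $k=0,1,2$ let $\Delta_k:\mathcal C\to\Sigma$, $\Delta_k(F)=F^{(k)}(1/2)/k!$. For distinct indices put $\langle\Delta_a,\Delta_b\rangle(F)=(\Delta_aF,\Delta_bF)$. Equalities are equalities of sets of sequences (or of pairs of sequences); each space carries its quotient norm $\|x\|=\inf\{\|F\|: F\in K,\ TF=x\}$ (for the space $T(K)$), and by the closed graph theorem algebraic equality implies equivalence of the norms. *)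

theory Defs
  imports Complex_Main "HOL-Library.Function_Algebras"
begin

text \<open>Spaces of complex sequences are given by a carrier set together with a norm function
  that is only meaningful on that carrier.\<close>

type_synonym cseq = "nat \<Rightarrow> complex"

definition linf :: "cseq set" where
  "linf = {x. bdd_above (range (\<lambda>n. cmod (x n)))}"

definition linf_norm :: "cseq \<Rightarrow> real" where
  "linf_norm x = (SUP n. cmod (x n))"

definition l1 :: "cseq set" where
  "l1 = {x. summable (\<lambda>n. cmod (x n))}"

definition l1_norm :: "cseq \<Rightarrow> real" where
  "l1_norm x = (\<Sum>n. cmod (x n))"

definition Sigma_space :: "cseq set" where
  "Sigma_space = {a + b | a b. a \<in> linf \<and> b \<in> l1}"

definition Sigma_norm :: "cseq \<Rightarrow> real" where
  "Sigma_norm x = Inf {linf_norm a + l1_norm b | a b. a \<in> linf \<and> b \<in> l1 \<and> x = a + b}"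

definition cont_wrt :: "(cseq \<Rightarrow> real) \<Rightarrow> 'a::topological_space set \<Rightarrow> ('a \<Rightarrow> cseq) \<Rightarrow> bool" where
  "cont_wrt N S f \<longleftrightarrow> (\<forall>z\<in>S. ((\<lambda>w. N (f w - f z)) \<longlongrightarrow> 0) (at z within S))"

definition has_Sigma_deriv :: "(complex \<Rightarrow> cseq) \<Rightarrow> cseq \<Rightarrow> complex \<Rightarrow> bool" where
  "has_Sigma_deriv F D z \<longleftrightarrow> D \<in> Sigma_space \<and>
     ((\<lambda>w. Sigma_norm (\<lambda>n. (F w n - F z n) / (w - z) - D n)) \<longlongrightarrow> 0) (at z)"

definition Sigma_deriv :: "(complex \<Rightarrow> cseq) \<Rightarrow> complex \<Rightarrow> cseq" where
  "Sigma_deriv F z = (THE D. has_Sigma_deriv F D z)"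

definition closed_strip :: "complex set" where
  "closed_strip = {z. 0 \<le> Re z \<and> Re z \<le> 1}"

definition open_strip :: "complex set" where
  "open_strip = {z. 0 < Re z \<and> Re z < 1}"

text \<open>The filter \<open>at_infinity\<close> on the reals expresses that the absolute value of \<open>t\<close> tends to
  infinity.\<close>

definition boundary_cond ::
  "cseq set \<Rightarrow> (cseq \<Rightarrow> real) \<Rightarrow> real \<Rightarrow> (complex \<Rightarrow> cseq) \<Rightarrow> bool" where
  "boundary_cond X N j F \<longleftrightarrow>
     (\<forall>t. F (Complex j t) \<in> X) \<and>
     cont_wrt N UNIV (\<lambda>t. F (Complex j t)) \<and>
     ((\<lambda>t. N (F (Complex j t))) \<longlongrightarrow> 0) at_infinity"

text \<open>Functions on the closed strip are represented by total functions whose values off the strip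
  are irrelevant. Analyticity means complex differentiability, in the norm of
  \<open>Sigma_space\<close>, at every point of the open strip.\<close>

definition calderon :: "(complex \<Rightarrow> cseq) set" where
  "calderon = {F.
     (\<forall>z\<in>closed_strip. F z \<in> Sigma_space) \<and>
     (\<exists>B. \<forall>z\<in>closed_strip. Sigma_norm (F z) \<le> B) \<and>
     cont_wrt Sigma_norm closed_strip F \<and>
     (\<forall>z\<in>open_strip. \<exists>D. has_Sigma_deriv F D z) \<and>
     boundary_cond linf linf_norm 0 F \<and>
     boundary_cond l1 l1_norm 1 F}"

definition Delta :: "nat \<Rightarrow> (complex \<Rightarrow> cseq) \<Rightarrow> cseq" where
  "Delta k F = (\<lambda>n. (Sigma_deriv ^^ k) F (1/2) n / fact k)"

definition Delta_pair :: "nat \<Rightarrow> nat \<Rightarrow> (complex \<Rightarrow> cseq) \<Rightarrow> cseq \<times> cseq" where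
  "Delta_pair a b F = (Delta a F, Delta b F)"

definition ker_Delta :: "nat \<Rightarrow> (complex \<Rightarrow> cseq) set" where
  "ker_Delta k = {F \<in> calderon. Delta k F = 0}"

end

(*
  Let h(z) = w + O(w^3) with w = z - 1/2 be bounded and analytic on the strip, with 1/h bounded away
  from 1/2.  Then G |-> h G maps the Calderon space bijectively onto ker Delta_0, and comparing Taylor
  coefficients, Delta_1 (h G) = Delta_0 G and Delta_2 (h G) = Delta_1 G.  This is equality (2), and it
  implies (1) and (3).  Since l_1 embeds in l_infinity, the sum space is l_infinity, so analyticity
  reduces to analyticity of the coordinates together with a common bound.
*)
theory Submission
  imports Defs "HOL-Complex_Analysis.Complex_Analysis"
begin

section \<open>The two sequence spaces\<close>

text \<open>Write h_i for the Taylor coefficients of h at 1/2, with h_0 = 0. The Leibniz rule gives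
  Delta_2 (h G) = h_1 Delta_1 G + h_2 Delta_0 G, so h_2 = 0 is what keeps Delta_0 G out of the
  second component. A simple zero alone does not achieve this: 2w / (w + 2) = w - w^2/2 + ... has
  the wrong second coefficient. The choice is h = w (1 + w) / (1 + w/2)^2. Since (1 + w/2)^(-2) = 1
  - w + ..., the factor 1 + w cancels the linear term. Numerator and denominator have the same
  degree, so h tends to 4 at infinity, and both h and 1/h are bounded there. The zero w = -1 and the
  double pole w = -2 lie to the left of the strip. The delicate direction is division by h. The
  value of the quotient at 1/2 is a limit taken in each coordinate, so norm continuity there is not
  inherited from a product; it is recovered from norm differentiability. The conditions on the two
  edges are inherited directly, because both edges stay away from 1/2.\<close>

locale seq_norm =
  fixes X :: "cseq set" and N :: "cseq \<Rightarrow> real"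
  assumes add_mem: "x \<in> X \<Longrightarrow> y \<in> X \<Longrightarrow> x + y \<in> X"
    and scale_mem: "x \<in> X \<Longrightarrow> (\<lambda>n. c * x n) \<in> X"
    and norm_nonneg: "x \<in> X \<Longrightarrow> 0 \<le> N x"
    and norm_triangle: "x \<in> X \<Longrightarrow> y \<in> X \<Longrightarrow> N (x + y) \<le> N x + N y"
    and norm_scale: "x \<in> X \<Longrightarrow> N (\<lambda>n. c * x n) = cmod c * N x"
begin

lemma diff_mem:
  assumes "x \<in> X" "y \<in> X"
  shows "x - y \<in> X"
proof -
  have "x - y = x + (\<lambda>n. (-1) * y n)"
    by (simp add: fun_eq_iff)
  then show ?thesis
    using assms add_mem scale_mem by metis
qed

text \<open>The product rule for limits, from m(w) f(w) - m(z) f(z) = m(w) (f(w) - f(z)) + (m(w) -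
  m(z)) f(z). Membership in \<open>X\<close> is carried along because \<open>N\<close> is meaningful
  only there.\<close>

lemma tendsto_scale:
  assumes f: "((\<lambda>w. N (f w - f z)) \<longlongrightarrow> 0) (at z within S)"
    and m: "(m \<longlongrightarrow> m z) (at z within S)"
    and z: "f z \<in> X" and mem: "\<forall>\<^sub>F w in at z within S. f w \<in> X"
  shows "((\<lambda>w. N ((\<lambda>n. m w * f w n) - (\<lambda>n. m z * f z n))) \<longlongrightarrow> 0) (at z within S)"
proof (rule tendsto_sandwich)
  show "((\<lambda>w. 0) \<longlongrightarrow> (0::real)) (at z within S)" by simp
  have "((\<lambda>w. cmod (m w) * N (f w - f z) + cmod (m w - m z) * N (f z)) \<longlongrightarrow>
      cmod (m z) * 0 + cmod (m z - m z) * N (f z)) (at z within S)"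
    by (intro tendsto_intros f m)
  then show "((\<lambda>w. cmod (m w) * N (f w - f z) + cmod (m w - m z) * N (f z)) \<longlongrightarrow> 0) (at z within S)"
    by simp
  show "\<forall>\<^sub>F w in at z within S. 0 \<le> N ((\<lambda>n. m w * f w n) - (\<lambda>n. m z * f z n))"
    using mem by eventually_elim (intro norm_nonneg diff_mem scale_mem z)
  show "\<forall>\<^sub>F w in at z within S. N ((\<lambda>n. m w * f w n) - (\<lambda>n. m z * f z n))
      \<le> cmod (m w) * N (f w - f z) + cmod (m w - m z) * N (f z)"
    using mem
  proof eventually_elim
    case (elim w)
    have d: "f w - f z \<in> X" using elim z by (rule diff_mem)
    have "(\<lambda>n. m w * f w n) - (\<lambda>n. m z * f z n)
        = (\<lambda>n. m w * (f w - f z) n) + (\<lambda>n. (m w - m z) * f z n)"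
      by (simp add: fun_eq_iff algebra_simps)
    then have "N ((\<lambda>n. m w * f w n) - (\<lambda>n. m z * f z n))
        \<le> N (\<lambda>n. m w * (f w - f z) n) + N (\<lambda>n. (m w - m z) * f z n)"
      using norm_triangle scale_mem d z by metis
    then show ?case
      using norm_scale d z by metis
  qed
qed

text \<open>Only homogeneity and the triangle inequality enter, so one argument serves the sup norm
  on one edge and the l1 norm on the other. \<open>G\<close> has to be a multiple of
  \<open>F\<close> only on the line itself, since inside the strip the multiplier may be
  singular.\<close>

lemma boundary_cond_scale:
  assumes F: "boundary_cond X N j F"
    and eq: "\<And>t. G (Complex j t) = (\<lambda>n. m t * F (Complex j t) n)"
    and m: "continuous_on UNIV m" and bd: "\<And>t. cmod (m t) \<le> M"
  shows "boundary_cond X N j G"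
proof -
  have mem: "F (Complex j t) \<in> X" for t
    using F by (simp add: boundary_cond_def)
  have "cont_wrt N UNIV (\<lambda>t. G (Complex j t))"
    unfolding cont_wrt_def eq
  proof
    fix t
    show "((\<lambda>s. N ((\<lambda>n. m s * F (Complex j s) n) - (\<lambda>n. m t * F (Complex j t) n))) \<longlongrightarrow> 0) (at t)"
    proof (rule tendsto_scale)
      show "((\<lambda>s. N (F (Complex j s) - F (Complex j t))) \<longlongrightarrow> 0) (at t)"
        using F by (simp add: boundary_cond_def cont_wrt_def)
      show "(m \<longlongrightarrow> m t) (at t)"
        using m by (simp add: continuous_on_def)
    qed (use mem in auto)
  qed
  moreover have "((\<lambda>t. N (G (Complex j t))) \<longlongrightarrow> 0) at_infinity"
  proof (rule tendsto_sandwich)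
    show "((\<lambda>t. 0) \<longlongrightarrow> (0::real)) (at_infinity :: real filter)" by simp
    have "((\<lambda>t. N (F (Complex j t))) \<longlongrightarrow> 0) at_infinity"
      using F by (simp add: boundary_cond_def)
    then show "((\<lambda>t. M * N (F (Complex j t))) \<longlongrightarrow> 0) at_infinity"
      by (rule tendsto_mult_right_zero)
    show "\<forall>\<^sub>F t in at_infinity. 0 \<le> N (G (Complex j t))"
      unfolding eq by (intro always_eventually allI norm_nonneg scale_mem mem)
    show "\<forall>\<^sub>F t in at_infinity. N (G (Complex j t)) \<le> M * N (F (Complex j t))"
      unfolding eq norm_scale[OF mem]
      by (intro always_eventually allI mult_right_mono bd norm_nonneg mem)
  qed
  ultimately show ?thesis
    by (simp add: boundary_cond_def eq scale_mem[OF mem])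
qed

end

section \<open>The concrete norms and the collapse of the sum space\<close>

lemma linfI: "(\<And>n. cmod (x n) \<le> B) \<Longrightarrow> x \<in> linf"
  by (auto simp: linf_def bdd_above_def)

lemma linf_norm_le: "(\<And>n. cmod (x n) \<le> B) \<Longrightarrow> linf_norm x \<le> B"
  unfolding linf_norm_def by (rule cSUP_least) auto

lemma cmod_le_linf_norm: "x \<in> linf \<Longrightarrow> cmod (x n) \<le> linf_norm x"
  unfolding linf_norm_def linf_def by (auto intro: cSUP_upper)

interpretation linf: seq_norm linf linf_norm
proof
  fix x y :: cseq and c
  assume x: "x \<in> linf"
  note le = cmod_le_linf_norm
  have c: "cmod (c * x n) \<le> cmod c * linf_norm x" for c n
    using le[OF x, of n] by (simp add: norm_mult mult_left_mono)
  show mem: "(\<lambda>n. c * x n) \<in> linf" for c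
    by (rule linfI[OF c])
  show "0 \<le> linf_norm x"
    using le[OF x, of 0] norm_ge_zero order_trans by blast
  show "linf_norm (\<lambda>n. c * x n) = cmod c * linf_norm x"
  proof (rule antisym)
    show "linf_norm (\<lambda>n. c * x n) \<le> cmod c * linf_norm x"
      by (rule linf_norm_le[OF c])
    show "cmod c * linf_norm x \<le> linf_norm (\<lambda>n. c * x n)"
    proof (cases "c = 0")
      case True
      then show ?thesis by (simp add: linf_norm_def)
    next
      case False
      have "linf_norm x \<le> linf_norm (\<lambda>n. c * x n) / cmod c"
      proof (rule linf_norm_le)
        fix n
        show "cmod (x n) \<le> linf_norm (\<lambda>n. c * x n) / cmod c"
          using le[OF mem, of c n] False by (simp add: norm_mult field_simps)
      qed
      then show ?thesis using False by (simp add: field_simps)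
    qed
  qed
  assume y: "y \<in> linf"
  have s: "cmod ((x + y) n) \<le> linf_norm x + linf_norm y" for n
    using le[OF x, of n] le[OF y, of n] norm_triangle_ineq[of "x n" "y n"] by simp
  show "x + y \<in> linf" by (rule linfI[OF s])
  show "linf_norm (x + y) \<le> linf_norm x + linf_norm y" by (rule linf_norm_le[OF s])
qed

interpretation l1: seq_norm l1 l1_norm
proof
  fix x y :: cseq and c
  assume x: "x \<in> l1"
  then have x': "summable (\<lambda>n. cmod (x n))" by (simp add: l1_def)
  show "(\<lambda>n. c * x n) \<in> l1"
    using x' by (simp add: l1_def norm_mult summable_mult)
  show "0 \<le> l1_norm x"
    unfolding l1_norm_def by (rule suminf_nonneg[OF x']) simp
  show "l1_norm (\<lambda>n. c * x n) = cmod c * l1_norm x"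
    using x' by (simp add: l1_norm_def norm_mult suminf_mult)
  assume y: "y \<in> l1"
  then have y': "summable (\<lambda>n. cmod (y n))" by (simp add: l1_def)
  have s: "summable (\<lambda>n. cmod (x n) + cmod (y n))"
    using x' y' by (rule summable_add)
  have s': "summable (\<lambda>n. cmod ((x + y) n))"
    by (rule summable_comparison_test'[OF s, of 0]) (simp add: norm_triangle_ineq)
  then show "x + y \<in> l1" by (simp add: l1_def)
  have "l1_norm (x + y) \<le> (\<Sum>n. cmod (x n) + cmod (y n))"
    unfolding l1_norm_def by (rule suminf_le[OF _ s' s]) (simp add: norm_triangle_ineq)
  also have "\<dots> = l1_norm x + l1_norm y"
    unfolding l1_norm_def by (rule suminf_add[OF x' y', symmetric])
  finally show "l1_norm (x + y) \<le> l1_norm x + l1_norm y" .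
qed

lemma cmod_le_l1_norm: "x \<in> l1 \<Longrightarrow> cmod (x n) \<le> l1_norm x"
  unfolding l1_def l1_norm_def using sum_le_suminf[of "\<lambda>n. cmod (x n)" "{n}"] by simp

lemma l1_subset_linf: "l1 \<subseteq> linf"
  using cmod_le_l1_norm linfI by blast

lemma zero_mem_l1: "0 \<in> l1" and l1_norm_zero: "l1_norm 0 = 0"
  by (simp_all add: l1_def l1_norm_def)

lemma Sigma_space_eq: "Sigma_space = linf"
proof
  show "Sigma_space \<subseteq> linf"
    using l1_subset_linf linf.add_mem by (auto simp: Sigma_space_def)
  show "linf \<subseteq> Sigma_space"
  proof
    fix x assume "x \<in> linf"
    then have "x = x + 0 \<and> x \<in> linf \<and> 0 \<in> l1"
      by (simp only: zero_mem_l1 add_0_right simp_thms)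
    then show "x \<in> Sigma_space" unfolding Sigma_space_def by blast
  qed
qed

text \<open>The infimum is attained at x = x + 0, and no other splitting does better because the l1
  norm dominates the sup norm.\<close>

lemma Sigma_norm_eq:
  assumes "x \<in> linf"
  shows "Sigma_norm x = linf_norm x"
  unfolding Sigma_norm_def
proof (rule cInf_eq_minimum)
  have "linf_norm x = linf_norm x + l1_norm 0 \<and> x \<in> linf \<and> 0 \<in> l1 \<and> x = x + 0"
    by (simp only: assms zero_mem_l1 l1_norm_zero add_0_right simp_thms)
  then show "linf_norm x \<in> {linf_norm a + l1_norm b | a b. a \<in> linf \<and> b \<in> l1 \<and> x = a + b}"
    by blast
next
  fix r
  assume "r \<in> {linf_norm a + l1_norm b | a b. a \<in> linf \<and> b \<in> l1 \<and> x = a + b}"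
  then obtain a b where ab: "r = linf_norm a + l1_norm b" "a \<in> linf" "b \<in> l1" "x = a + b"
    by blast
  have "linf_norm x \<le> linf_norm a + linf_norm b"
    using ab l1_subset_linf linf.norm_triangle by blast
  also have "linf_norm b \<le> l1_norm b"
    by (rule linf_norm_le[OF cmod_le_l1_norm[OF ab(3)]])
  finally show "linf_norm x \<le> r" by (simp add: ab(1))
qed

section \<open>Analyticity in the norm of the sum space\<close>

text \<open>This is the Taylor remainder of order two divided by |w - z|. The point is that the
  constant depends only on \<open>B\<close> and \<open>r\<close>, hence is the same for all
  coordinates of a bounded family.\<close>

lemma difference_quotient_bound:
  assumes f: "f holomorphic_on ball z r" and r: "0 < r"
    and bd: "\<And>w. w \<in> ball z r \<Longrightarrow> cmod (f w) \<le> B"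
    and w: "w \<in> ball z (r/2)" "w \<noteq> z"
  shows "cmod ((f w - f z) / (w - z) - deriv f z) \<le> (2 * B / (r/3)^2) * cmod (w - z)"
proof -
  have der: "((deriv ^^ i) f has_field_derivative (deriv ^^ Suc i) f x) (at x within ball z (r/2))"
    if "x \<in> ball z (r/2)" for i x
  proof -
    have "(deriv ^^ i) f holomorphic_on ball z r"
      using f by (rule holomorphic_higher_deriv) simp
    moreover have "x \<in> ball z r" using that r by simp
    ultimately have "((deriv ^^ i) f has_field_derivative deriv ((deriv ^^ i) f) x) (at x)"
      using holomorphic_derivI open_ball by blast
    then show ?thesis using has_field_derivative_at_within by simp
  qed
  have second: "cmod ((deriv ^^ 2) f x) \<le> 2 * B / (r/3)^2" if x: "x \<in> ball z (r/2)" for x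
  proof -
    \<comment> \<open>Since r/2 + r/3 < r, discs of radius r/3 about points of the half ball stay in
      the domain. Cauchy's inequality then bounds the second derivative on the whole convex half
      ball, as the Taylor remainder requires.\<close>
    have sub: "cball x (r/3) \<subseteq> ball z r"
    proof
      fix y assume "y \<in> cball x (r/3)"
      then show "y \<in> ball z r"
        using x r dist_triangle[of z y x] by simp
    qed
    have "cmod ((deriv ^^ 2) f x) \<le> fact 2 * B / (r/3)^2"
    proof (rule Cauchy_inequality)
      show "f holomorphic_on ball x (r/3)"
        using f sub ball_subset_cball holomorphic_on_subset by blast
      show "continuous_on (cball x (r/3)) f"
        using f sub holomorphic_on_subset holomorphic_on_imp_continuous_on by blast
      show "cmod (f y) \<le> B" if "cmod (x - y) = r/3" for y
        using that sub bd by (force simp: dist_norm)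
    qed (use r in simp)
    then show ?thesis by (simp add: fact_2)
  qed
  have "cmod ((deriv ^^ 0) f w - (\<Sum>i\<le>1. (deriv ^^ i) f z * (w - z)^i / fact i))
      \<le> (2 * B / (r/3)^2) * cmod (w - z)^(Suc 1) / fact 1"
  proof (rule complex_Taylor)
    show "convex (ball z (r/2))" by (rule convex_ball)
  qed (use der second w r in \<open>auto simp: numeral_2_eq_2\<close>)
  then have est: "cmod (f w - f z - deriv f z * (w - z)) \<le> (2 * B / (r/3)^2) * cmod (w - z)^2"
    by (simp add: algebra_simps numeral_2_eq_2)
  have "(f w - f z) / (w - z) - deriv f z = (f w - f z - deriv f z * (w - z)) / (w - z)"
    using w(2) by (simp add: field_simps)
  then have "cmod ((f w - f z) / (w - z) - deriv f z)
      = cmod (f w - f z - deriv f z * (w - z)) / cmod (w - z)"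
    by (simp add: norm_divide)
  also have "\<dots> \<le> (2 * B / (r/3)^2) * cmod (w - z)^2 / cmod (w - z)"
    using est by (rule divide_right_mono) simp
  also have "\<dots> = (2 * B / (r/3)^2) * cmod (w - z)"
    by (simp add: power2_eq_square)
  finally show ?thesis .
qed

lemma deriv_mem_linf:
  assumes f: "\<And>n. (\<lambda>w. F w n) holomorphic_on ball z r" and r: "0 < r"
    and bd: "\<And>w n. w \<in> ball z r \<Longrightarrow> cmod (F w n) \<le> B"
  shows "(\<lambda>n. deriv (\<lambda>w. F w n) z) \<in> linf"
proof (rule linfI)
  fix n
  have sub: "cball z (r/2) \<subseteq> ball z r" using r by auto
  have "cmod ((deriv ^^ 1) (\<lambda>w. F w n) z) \<le> fact 1 * B / (r/2)^1"
  proof (rule Cauchy_inequality)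
    show "(\<lambda>w. F w n) holomorphic_on ball z (r/2)"
      using f sub ball_subset_cball holomorphic_on_subset by blast
    show "continuous_on (cball z (r/2)) (\<lambda>w. F w n)"
      using f sub holomorphic_on_subset holomorphic_on_imp_continuous_on by blast
    show "cmod (F y n) \<le> B" if "cmod (z - y) = r/2" for y
      using that r by (intro bd) (simp add: dist_norm)
  qed (use r in simp)
  then show "cmod (deriv (\<lambda>w. F w n) z) \<le> B / (r/2)" by simp
qed

text \<open>The error of the difference quotient in coordinate n is at most K |w - z| with K
  independent of n, so the bound passes to the supremum over n.\<close>

lemma has_Sigma_deriv_coordinatewise:
  assumes f: "\<And>n. (\<lambda>w. F w n) holomorphic_on ball z r" and r: "0 < r"
    and bd: "\<And>w n. w \<in> ball z r \<Longrightarrow> cmod (F w n) \<le> B"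
  shows "has_Sigma_deriv F (\<lambda>n. deriv (\<lambda>w. F w n) z) z"
proof -
  let ?D = "\<lambda>n. deriv (\<lambda>w. F w n) z"
  let ?q = "\<lambda>w n. (F w n - F z n) / (w - z) - ?D n"
  let ?K = "2 * B / (r/3)^2"
  have D: "?D \<in> linf" using f r bd by (rule deriv_mem_linf)
  have q: "cmod (?q w n) \<le> ?K * cmod (w - z)" if "w \<in> ball z (r/2)" "w \<noteq> z" for w n
    using difference_quotient_bound[OF f r bd that] .
  have near: "\<forall>\<^sub>F w in at z. w \<in> ball z (r/2) \<and> w \<noteq> z"
    unfolding eventually_at using r by (intro exI[of _ "r/2"]) (auto simp: dist_commute)
  have ev: "\<forall>\<^sub>F w in at z. 0 \<le> Sigma_norm (?q w) \<and> Sigma_norm (?q w) \<le> ?K * cmod (w - z)"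
    using near
  proof eventually_elim
    case (elim w)
    then have qw: "cmod (?q w n) \<le> ?K * cmod (w - z)" for n
      using q by blast
    have mem: "?q w \<in> linf" using qw by (rule linfI)
    have "linf_norm (?q w) \<le> ?K * cmod (w - z)" using qw by (rule linf_norm_le)
    then show ?case
      unfolding Sigma_norm_eq[OF mem] using linf.norm_nonneg[OF mem] by blast
  qed
  have "((\<lambda>w. Sigma_norm (?q w)) \<longlongrightarrow> 0) (at z)"
  proof (rule tendsto_sandwich)
    show "((\<lambda>w. 0) \<longlongrightarrow> (0::real)) (at z)" by simp
    have "((\<lambda>w. ?K * cmod (w - z)) \<longlongrightarrow> ?K * cmod (z - z)) (at z)"
      by (intro tendsto_intros)
    then show "((\<lambda>w. ?K * cmod (w - z)) \<longlongrightarrow> 0) (at z)" by simp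
  qed (use ev in \<open>auto elim: eventually_mono\<close>)
  then show ?thesis
    using D by (simp add: has_Sigma_deriv_def Sigma_space_eq)
qed

text \<open>Evaluating a coordinate does not increase the sup norm. Membership is asked for only
  near \<open>z\<close>, because values off the strip are arbitrary.\<close>

lemma has_Sigma_deriv_imp_coordinate:
  assumes D: "has_Sigma_deriv F D z" and mem: "\<forall>\<^sub>F w in at z. F w \<in> linf" and z: "F z \<in> linf"
  shows "((\<lambda>w. F w n) has_field_derivative D n) (at z)"
proof -
  let ?q = "\<lambda>w n. (F w n - F z n) / (w - z) - D n"
  have Dm: "D \<in> linf" using D by (simp add: has_Sigma_deriv_def Sigma_space_eq)
  have ev: "\<forall>\<^sub>F w in at z. cmod (?q w n) \<le> Sigma_norm (?q w)"
    using mem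
  proof eventually_elim
    case (elim w)
    have "?q w = (\<lambda>n. inverse (w - z) * (F w - F z) n) - D"
      by (simp add: fun_eq_iff divide_inverse mult.commute)
    then have "?q w \<in> linf"
      by (simp only: linf.diff_mem[OF linf.scale_mem[OF linf.diff_mem[OF elim z]] Dm])
    then show ?case using cmod_le_linf_norm[of "?q w" n] by (simp only: Sigma_norm_eq)
  qed
  have "((\<lambda>w. ?q w n) \<longlongrightarrow> 0) (at z)"
    using D unfolding has_Sigma_deriv_def by (intro Lim_null_comparison[OF ev]) blast
  then show ?thesis
    unfolding has_field_derivative_iff using LIM_zero_cancel by fastforce
qed

text \<open>The definite description is unique because the coordinates of a norm derivative are
  ordinary derivatives.\<close>

lemma Sigma_deriv_eqI:
  assumes D: "has_Sigma_deriv F D z" and mem: "\<forall>\<^sub>F w in at z. F w \<in> linf" and z: "F z \<in> linf"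
  shows "Sigma_deriv F z = D"
  unfolding Sigma_deriv_def
proof (rule the_equality)
  show "has_Sigma_deriv F D z" by (rule D)
next
  fix E assume E: "has_Sigma_deriv F E z"
  show "E = D"
    using DERIV_unique has_Sigma_deriv_imp_coordinate[OF _ mem z] D E by blast
qed

text \<open>Differentiability implies continuity, via F(w) - F(z) = (w - z) (q(w) + D), where q(w)
  is the error of the difference quotient. It serves at the point 1/2, where a quotient by the
  multiplier is no longer a product of continuous factors.\<close>

lemma has_Sigma_deriv_imp_tendsto:
  assumes D: "has_Sigma_deriv F D z" and mem: "\<forall>\<^sub>F w in at z. F w \<in> linf" and z: "F z \<in> linf"
  shows "((\<lambda>w. Sigma_norm (F w - F z)) \<longlongrightarrow> 0) (at z)"
proof (rule tendsto_sandwich)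
  let ?q = "\<lambda>w n. (F w n - F z n) / (w - z) - D n"
  let ?b = "\<lambda>w. cmod (w - z) * (Sigma_norm (?q w) + linf_norm D)"
  have Dm: "D \<in> linf" using D by (simp add: has_Sigma_deriv_def Sigma_space_eq)
  show "((\<lambda>w. 0) \<longlongrightarrow> (0::real)) (at z)" by simp
  have "(?b \<longlongrightarrow> cmod (z - z) * (0 + linf_norm D)) (at z)"
    using D unfolding has_Sigma_deriv_def by (intro tendsto_intros) blast
  then show "(?b \<longlongrightarrow> 0) (at z)" by simp
  show "\<forall>\<^sub>F w in at z. 0 \<le> Sigma_norm (F w - F z)"
    using mem by eventually_elim (simp add: Sigma_norm_eq linf.norm_nonneg linf.diff_mem z)
  show "\<forall>\<^sub>F w in at z. Sigma_norm (F w - F z) \<le> ?b w"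
    using mem eventually_neq_at_within[of z]
  proof eventually_elim
    case (elim w)
    have d: "F w - F z \<in> linf" using elim z by (simp add: linf.diff_mem)
    have "?q w = (\<lambda>n. inverse (w - z) * (F w - F z) n) - D"
      by (simp add: fun_eq_iff divide_inverse mult.commute)
    then have q: "?q w \<in> linf"
      by (simp only: linf.diff_mem[OF linf.scale_mem[OF d] Dm])
    have "F w - F z = (\<lambda>n. (w - z) * (?q w + D) n)"
      using elim by (simp add: fun_eq_iff field_simps)
    then have "linf_norm (F w - F z) = linf_norm (\<lambda>n. (w - z) * (?q w + D) n)"
      by (rule arg_cong)
    also have "\<dots> = cmod (w - z) * linf_norm (?q w + D)"
      by (rule linf.norm_scale[OF linf.add_mem[OF q Dm]])
    also have "\<dots> \<le> cmod (w - z) * (linf_norm (?q w) + linf_norm D)"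
      by (intro mult_left_mono linf.norm_triangle q Dm) simp
    finally show ?case
      by (simp only: Sigma_norm_eq[OF d] Sigma_norm_eq[OF q])
  qed
qed

section \<open>The Calderon space in coordinates\<close>

lemma open_open_strip: "open open_strip"
proof -
  have "open_strip = {z. 0 < Re z} \<inter> {z. Re z < 1}"
    by (auto simp: open_strip_def)
  then show ?thesis
    using open_Int[OF open_halfspace_Re_gt open_halfspace_Re_lt] by metis
qed

lemma open_strip_subset: "open_strip \<subseteq> closed_strip"
  by (auto simp: open_strip_def closed_strip_def)

lemma half_in_open_strip: "1/2 \<in> open_strip"
  by (simp add: open_strip_def)

lemma calderon_mem_linf: "F \<in> calderon \<Longrightarrow> z \<in> closed_strip \<Longrightarrow> F z \<in> linf"
  by (simp add: calderon_def Sigma_space_eq)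

lemma calderon_bounded:
  assumes "F \<in> calderon"
  obtains B where "0 \<le> B" "\<And>z n. z \<in> closed_strip \<Longrightarrow> cmod (F z n) \<le> B"
proof -
  obtain B where B: "\<And>z. z \<in> closed_strip \<Longrightarrow> Sigma_norm (F z) \<le> B"
    using assms by (auto simp: calderon_def)
  have *: "cmod (F z n) \<le> B" if "z \<in> closed_strip" for z n
    using cmod_le_linf_norm[OF calderon_mem_linf[OF assms that], of n] B[OF that]
      Sigma_norm_eq[OF calderon_mem_linf[OF assms that]] by simp
  moreover have "0 \<le> B"
    using *[of "1/2" 0] half_in_open_strip open_strip_subset norm_ge_zero order_trans by blast
  ultimately show ?thesis using that by blast
qed

lemma eventually_at_open_strip: "z \<in> open_strip \<Longrightarrow> \<forall>\<^sub>F w in at z. w \<in> open_strip"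
  using eventually_at_in_open' open_open_strip by blast

lemma calderon_coordinate_holomorphic:
  assumes F: "F \<in> calderon"
  shows "(\<lambda>w. F w n) holomorphic_on open_strip"
  unfolding holomorphic_on_open[OF open_open_strip]
proof
  fix z assume z: "z \<in> open_strip"
  obtain D where D: "has_Sigma_deriv F D z"
    using F z by (auto simp: calderon_def)
  have "\<forall>\<^sub>F w in at z. F w \<in> linf"
    using eventually_at_open_strip[OF z] calderon_mem_linf[OF F] open_strip_subset
    by (auto elim!: eventually_mono)
  moreover have "F z \<in> linf" using z open_strip_subset calderon_mem_linf[OF F] by blast
  ultimately show "\<exists>f'. ((\<lambda>w. F w n) has_field_derivative f') (at z)"
    using has_Sigma_deriv_imp_coordinate[OF D] by blast
qed

text \<open>Derivatives of a bounded function may blow up towards the edges, so a bound common to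
  all coordinates is available only locally. This is what
  \<open>has_Sigma_deriv_coordinatewise\<close> needs in order to differentiate once more.\<close>

lemma higher_deriv_coordinate_bound:
  assumes F: "F \<in> calderon" and z: "z \<in> open_strip"
  obtains r B where "0 < r" "ball z r \<subseteq> open_strip"
    "\<And>w n. w \<in> ball z r \<Longrightarrow> cmod ((deriv ^^ k) (\<lambda>w. F w n) w) \<le> B"
proof -
  obtain B where B: "\<And>z n. z \<in> closed_strip \<Longrightarrow> cmod (F z n) \<le> B"
    using calderon_bounded[OF F] by blast
  obtain r where r: "0 < r" "ball z r \<subseteq> open_strip"
    using z open_open_strip open_contains_ball by blast
  have "cmod ((deriv ^^ k) (\<lambda>w. F w n) w) \<le> fact k * B / (r/3)^k" if w: "w \<in> ball z (r/2)" for w n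
  proof (rule Cauchy_inequality)
    have sub: "cball w (r/3) \<subseteq> open_strip"
    proof
      fix y assume "y \<in> cball w (r/3)"
      then have "y \<in> ball z r" using w r dist_triangle[of z y w] by simp
      then show "y \<in> open_strip" using r by blast
    qed
    note hol = calderon_coordinate_holomorphic[OF F, of n]
    show "(\<lambda>w. F w n) holomorphic_on ball w (r/3)"
      using hol sub ball_subset_cball holomorphic_on_subset by blast
    show "continuous_on (cball w (r/3)) (\<lambda>w. F w n)"
      using hol sub holomorphic_on_subset holomorphic_on_imp_continuous_on by blast
    show "cmod (F y n) \<le> B" if "cmod (w - y) = r/3" for y
      using that sub open_strip_subset by (intro B) (force simp: dist_norm)
  qed (use r in simp)
  moreover have "0 < r/2" "ball z (r/2) \<subseteq> open_strip"
    using r by auto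
  ultimately show ?thesis using that by blast
qed

text \<open>The claim ranges over the whole open strip, not just 1/2, because each further
  derivative depends on the previous one in a neighbourhood. The induction compares functions on a
  small ball, where the hypothesis for k applies.\<close>

lemma Sigma_deriv_power_coordinate:
  assumes F: "F \<in> calderon" and "z \<in> open_strip"
  shows "(Sigma_deriv ^^ k) F z = (\<lambda>n. (deriv ^^ k) (\<lambda>w. F w n) z)"
  using assms(2)
proof (induction k arbitrary: z)
  case 0
  then show ?case by simp
next
  case (Suc k)
  let ?G = "(Sigma_deriv ^^ k) F"
  let ?H = "\<lambda>w n. (deriv ^^ k) (\<lambda>w. F w n) w"
  obtain r B where r: "0 < r" "ball z r \<subseteq> open_strip"
    and B: "\<And>w n. w \<in> ball z r \<Longrightarrow> cmod (?H w n) \<le> B"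
    using higher_deriv_coordinate_bound[OF F Suc.prems] by blast
  have H: "(\<lambda>w. ?H w n) holomorphic_on ball z r" for n
    using holomorphic_higher_deriv[OF calderon_coordinate_holomorphic[OF F] open_open_strip]
      r(2) holomorphic_on_subset by blast
  have GH: "?G w = ?H w" if "w \<in> ball z r" for w
    using Suc.IH that r(2) by blast
  have nbhd: "\<forall>\<^sub>F w in nhds z. w \<in> ball z r"
    by (rule eventually_nhds_in_open[OF open_ball]) (use r(1) in simp)
  have lin: "?G w \<in> linf" if "w \<in> ball z r" for w
    unfolding GH[OF that] using B[OF that] by (rule linfI)
  have "has_Sigma_deriv ?G (\<lambda>n. deriv (\<lambda>w. ?G w n) z) z"
  proof (rule has_Sigma_deriv_coordinatewise[OF _ r(1)])
    show "(\<lambda>w. ?G w n) holomorphic_on ball z r" for n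
      using H[of n] by (subst holomorphic_cong[OF refl, of _ _ "\<lambda>w. ?H w n"]) (use GH in auto)
    show "cmod (?G w n) \<le> B" if "w \<in> ball z r" for w n
      using B GH that by simp
  qed
  then have "Sigma_deriv ?G z = (\<lambda>n. deriv (\<lambda>w. ?G w n) z)"
  proof (rule Sigma_deriv_eqI)
    show "\<forall>\<^sub>F w in at z. ?G w \<in> linf"
      using nbhd lin by (auto simp: eventually_at_filter elim!: eventually_mono)
    show "?G z \<in> linf" using lin r(1) by simp
  qed
  also have "\<dots> = (\<lambda>n. deriv (\<lambda>w. ?H w n) z)"
  proof
    fix n
    show "deriv (\<lambda>w. ?G w n) z = deriv (\<lambda>w. ?H w n) z"
      using nbhd by (intro deriv_cong_ev) (auto simp: GH elim!: eventually_mono)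
  qed
  finally show ?case by simp
qed

lemma Delta_coordinate:
  "F \<in> calderon \<Longrightarrow> Delta k F n = (deriv ^^ k) (\<lambda>w. F w n) (1/2) / fact k"
  by (simp add: Delta_def Sigma_deriv_power_coordinate half_in_open_strip)

lemma Complex_in_closed_strip: "j = 0 \<or> j = 1 \<Longrightarrow> Complex j t \<in> closed_strip"
  by (auto simp: closed_strip_def)

text \<open>The edges are at distance at least 1/2 from the centre. The value 1/4 is the radius of
  the disc used for the maximum principle, which therefore stays clear of both edges.\<close>

lemma Complex_far_from_half:
  assumes "j = 0 \<or> j = 1"
  shows "1/4 \<le> dist (1/2) (Complex j t)"
proof -
  have "\<bar>Re (1/2 - Complex j t)\<bar> = 1/2" using assms by auto
  then show ?thesis using abs_Re_le_cmod[of "1/2 - Complex j t"] by (simp add: dist_norm)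
qed

lemma Complex_ne_half: "j = 0 \<or> j = 1 \<Longrightarrow> Complex j t \<noteq> 1/2"
  using Complex_far_from_half[of j t]
  by (metis dist_self zero_less_divide_1_iff zero_less_numeral not_le)

text \<open>The multiplier may have a pole at \<open>1/2\<close>: near that point the bound on \<open>G\<close>
  comes from the maximum principle, applied to each coordinate.\<close>

lemma calderon_multiplier:
  assumes F: "F \<in> calderon"
    and hol: "\<And>n. (\<lambda>z. G z n) holomorphic_on open_strip"
    and eq: "\<And>z n. z \<in> closed_strip \<Longrightarrow> z \<noteq> 1/2 \<Longrightarrow> G z n = m z * F z n"
    and cont: "continuous_on (closed_strip - {1/2}) m"
    and bd: "\<And>z. z \<in> closed_strip \<Longrightarrow> 1/4 \<le> dist (1/2) z \<Longrightarrow> cmod (m z) \<le> M"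
  shows "G \<in> calderon"
proof -
  obtain B where B0: "0 \<le> B" and B: "\<And>z n. z \<in> closed_strip \<Longrightarrow> cmod (F z n) \<le> B"
    using calderon_bounded[OF F] by blast
  have far: "cmod (G z n) \<le> M * B" if z: "z \<in> closed_strip" "1/4 \<le> dist (1/2) z" for z n
  proof -
    have "z \<noteq> 1/2" using z(2) by (metis dist_self zero_less_divide_1_iff zero_less_numeral not_le)
    then have "cmod (G z n) = cmod (m z) * cmod (F z n)"
      using eq z by (simp add: norm_mult)
    also have "\<dots> \<le> M * B"
      using bd[OF z] B[OF z(1), of n] norm_ge_zero order_trans[OF norm_ge_zero bd[OF z]]
      by (intro mult_mono) auto
    finally show ?thesis .
  qed
  have disc: "cball (1/2) (1/4) \<subseteq> open_strip"
  proof
    fix z :: complex assume "z \<in> cball (1/2) (1/4)"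
    then show "z \<in> open_strip"
      using abs_Re_le_cmod[of "1/2 - z"] by (auto simp: open_strip_def dist_norm)
  qed
  have bound: "cmod (G z n) \<le> M * B" if z: "z \<in> closed_strip" for z n
  proof (cases "1/4 \<le> dist (1/2) z")
    case True
    then show ?thesis using far z by blast
  next
    case False
    show ?thesis
    proof (rule maximum_modulus_frontier[where S = "ball (1/2) (1/4)" and f = "\<lambda>z. G z n"])
      show "(\<lambda>z. G z n) holomorphic_on interior (ball (1/2) (1/4))"
        using hol disc ball_subset_cball holomorphic_on_subset by (simp, blast)
      show "continuous_on (closure (ball (1/2) (1/4))) (\<lambda>z. G z n)"
        using hol disc holomorphic_on_subset holomorphic_on_imp_continuous_on by (simp, blast)
      show "bounded (ball (1/2) (1/4) :: complex set)" by simp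
      show "cmod (G w n) \<le> M * B" if "w \<in> frontier (ball (1/2) (1/4))" for w
      proof (rule far)
        have w: "dist (1/2) w = 1/4" using that by simp
        then have "w \<in> cball (1/2) (1/4)" by simp
        then show "w \<in> closed_strip" using disc open_strip_subset by blast
        show "1/4 \<le> dist (1/2) w" using w by simp
      qed
      show "z \<in> ball (1/2) (1/4)" using False by simp
    qed
  qed
  have mem: "G z \<in> linf" if "z \<in> closed_strip" for z
    using bound[OF that] by (rule linfI)
  have nrm: "Sigma_norm (G z) \<le> M * B" if "z \<in> closed_strip" for z
    unfolding Sigma_norm_eq[OF mem[OF that]] using bound[OF that] by (rule linf_norm_le)
  have deriv: "has_Sigma_deriv G (\<lambda>n. deriv (\<lambda>w. G w n) z) z" if z: "z \<in> open_strip" for z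
  proof -
    obtain r where r: "0 < r" "ball z r \<subseteq> open_strip"
      using z open_open_strip open_contains_ball by blast
    show ?thesis
      by (rule has_Sigma_deriv_coordinatewise[OF _ r(1), where B = "M * B"])
        (use hol r(2) holomorphic_on_subset bound open_strip_subset in blast)+
  qed
  have tend: "((\<lambda>w. Sigma_norm (G w - G z)) \<longlongrightarrow> 0) (at z within closed_strip)"
    if z: "z \<in> closed_strip" for z
  proof (cases "z = 1/2")
    case True
    then have z': "z \<in> open_strip" using half_in_open_strip by (simp only:)
    have "\<forall>\<^sub>F w in at z. G w \<in> linf"
      using eventually_at_open_strip[OF z'] mem open_strip_subset by (auto elim!: eventually_mono)
    then show ?thesis
      using has_Sigma_deriv_imp_tendsto[OF deriv[OF z']] mem[OF z] tendsto_within_subset by blast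
  next
    case False
    have inS: "\<forall>\<^sub>F w in at z within closed_strip. w \<in> closed_strip \<and> w \<noteq> 1/2"
      using False
      by (intro eventually_at_topological[THEN iffD2] exI[of _ "- {1/2}"]) auto
    have Fz: "F w \<in> linf" if "w \<in> closed_strip" for w
      using calderon_mem_linf[OF F that] .
    have "((\<lambda>w. linf_norm ((\<lambda>n. m w * F w n) - (\<lambda>n. m z * F z n))) \<longlongrightarrow> 0) (at z within closed_strip)"
    proof (rule linf.tendsto_scale)
      have "((\<lambda>w. Sigma_norm (F w - F z)) \<longlongrightarrow> 0) (at z within closed_strip)"
        using F z by (simp add: calderon_def cont_wrt_def)
      then show "((\<lambda>w. linf_norm (F w - F z)) \<longlongrightarrow> 0) (at z within closed_strip)"
        by (rule Lim_transform_eventually)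
          (use inS in \<open>auto simp: Sigma_norm_eq linf.diff_mem Fz z elim!: eventually_mono\<close>)
      have "(m \<longlongrightarrow> m z) (at z within closed_strip - {1/2})"
        using cont z False by (simp add: continuous_on_def)
      \<comment> \<open>Deleting 1/2 does not change the filter at \<open>z\<close>, as
        \<open>z\<close> has a neighbourhood that avoids this point.\<close>
      moreover have "at z within closed_strip - {1/2} = at z within closed_strip"
        using False by (intro at_within_nhd[where S = "- {1/2}"]) auto
      ultimately show "(m \<longlongrightarrow> m z) (at z within closed_strip)" by simp
      show "F z \<in> linf" using Fz z .
      show "\<forall>\<^sub>F w in at z within closed_strip. F w \<in> linf"
        using inS by (auto simp: Fz elim!: eventually_mono)
    qed
    then show ?thesis
    proof (rule Lim_transform_eventually)
      show "\<forall>\<^sub>F w in at z within closed_strip.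
          linf_norm ((\<lambda>n. m w * F w n) - (\<lambda>n. m z * F z n)) = Sigma_norm (G w - G z)"
        using inS
      proof eventually_elim
        case (elim w)
        have "G w = (\<lambda>n. m w * F w n)" "G z = (\<lambda>n. m z * F z n)"
          using eq elim z False by auto
        moreover have "Sigma_norm (G w - G z) = linf_norm (G w - G z)"
          by (intro Sigma_norm_eq linf.diff_mem mem) (use elim z in auto)
        ultimately show ?case by simp
      qed
    qed
  qed
  have bdry_eq: "G (Complex j t) = (\<lambda>n. m (Complex j t) * F (Complex j t) n)"
    and bdry_bd: "cmod (m (Complex j t)) \<le> M" if j: "j = 0 \<or> j = 1" for j t
  proof -
    show "G (Complex j t) = (\<lambda>n. m (Complex j t) * F (Complex j t) n)"
      using eq[OF Complex_in_closed_strip[OF j] Complex_ne_half[OF j]] by auto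
    show "cmod (m (Complex j t)) \<le> M"
      by (rule bd[OF Complex_in_closed_strip[OF j] Complex_far_from_half[OF j]])
  qed
  have bdry_cont: "continuous_on UNIV (\<lambda>t. m (Complex j t))" if j: "j = 0 \<or> j = 1" for j
  proof (rule continuous_on_compose2[OF cont])
    show "continuous_on UNIV (Complex j)"
      by (simp add: Complex_eq continuous_intros)
    show "range (Complex j) \<subseteq> closed_strip - {1/2}"
      using Complex_in_closed_strip[OF j] Complex_ne_half[OF j]
      by (intro image_subsetI DiffI) (simp_all only: singleton_iff not_False_eq_True)
  qed
  have "boundary_cond linf linf_norm 0 G"
    by (rule linf.boundary_cond_scale[where F = F and M = M and m = "\<lambda>t. m (Complex 0 t)"])
      (use F bdry_eq bdry_bd bdry_cont in \<open>auto simp: calderon_def\<close>)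
  moreover have "boundary_cond l1 l1_norm 1 G"
    by (rule l1.boundary_cond_scale[where F = F and M = M and m = "\<lambda>t. m (Complex 1 t)"])
      (use F bdry_eq bdry_bd bdry_cont in \<open>auto simp: calderon_def\<close>)
  ultimately show ?thesis
    unfolding calderon_def cont_wrt_def mem_Collect_eq Sigma_space_eq
    using mem nrm deriv tend by blast
qed

section \<open>The multiplier\<close>

text \<open>With \<open>w = z - 1/2\<close> this is \<open>w + O(w\<^sup>3)\<close> at \<open>w = 0\<close>, and the poles and the
  other zero lie off the strip.\<close>

definition strip_mult :: "complex \<Rightarrow> complex" where
  "strip_mult z = 4 * (z - 1/2) * (z + 1/2) / (z + 3/2)^2"

lemma strip_denominators:
  assumes "z \<in> closed_strip"
  shows "1/2 \<le> cmod (z + 1/2)" "1 \<le> cmod (z + 3/2)" "z + 1/2 \<noteq> 0" "z + 3/2 \<noteq> 0"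
proof -
  have "1/2 \<le> Re (z + 1/2)" "1 \<le> Re (z + 3/2)"
    using assms by (auto simp: closed_strip_def)
  then show "1/2 \<le> cmod (z + 1/2)" "1 \<le> cmod (z + 3/2)"
    using complex_Re_le_cmod order_trans by blast+
  then show "z + 1/2 \<noteq> 0" "z + 3/2 \<noteq> 0" by auto
qed

lemma strip_mult_holomorphic: "strip_mult holomorphic_on closed_strip"
  unfolding strip_mult_def by (intro holomorphic_intros) (use strip_denominators in auto)

lemma strip_mult_nonzero:
  assumes "z \<in> closed_strip" "z \<noteq> 1/2"
  shows "strip_mult z \<noteq> 0"
proof -
  have "z - 1/2 \<noteq> 0" using assms(2) by (metis eq_iff_diff_eq_0)
  then show ?thesis
    using strip_denominators[OF assms(1)] unfolding strip_mult_def
    by (simp only: divide_eq_0_iff mult_eq_0_iff power_eq_0_iff zero_neq_numeral) simp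
qed

text \<open>In u = z + 3/2 the numerator is 4 (u - 2) (u - 1). The resulting powers of 1/u are easy
  to estimate, since |u| is at least 1 on the strip, and easy to differentiate twice.\<close>

lemma strip_mult_partial_fractions:
  assumes "z + 3/2 \<noteq> 0"
  shows "strip_mult z = 4 - 12 / (z + 3/2) + 8 / (z + 3/2)^2"
proof -
  define u where "u = z + 3/2"
  have u: "u \<noteq> 0" "z - 1/2 = u - 2" "z + 1/2 = u - 1"
    using assms by (simp_all add: u_def)
  show ?thesis
    unfolding strip_mult_def u_def[symmetric] u(2,3)
    using u(1) by (simp add: field_simps power2_eq_square)
qed

text \<open>24 = 4 + 12 + 8, one summand for each partial fraction.\<close>

lemma strip_mult_bound:
  assumes z: "z \<in> closed_strip"
  shows "cmod (strip_mult z) \<le> 24"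
proof -
  note d = strip_denominators[OF z]
  have "cmod (strip_mult z) \<le> cmod (4 - 12 / (z + 3/2)) + cmod (8 / (z + 3/2)^2)"
    unfolding strip_mult_partial_fractions[OF d(4)] by (rule norm_triangle_ineq)
  also have "cmod (4 - 12 / (z + 3/2)) \<le> 4 + cmod (12 / (z + 3/2))"
    using norm_triangle_ineq4[of 4 "12 / (z + 3/2)"] by simp
  also have "cmod (12 / (z + 3/2)) \<le> 12"
    using d(2) frac_le[of 12 12 1 "cmod (z + 3/2)"] by (simp add: norm_divide)
  also have "cmod (8 / (z + 3/2)^2) \<le> 8"
    using one_le_power[OF d(2), of 2] frac_le[of 8 8 1 "cmod (z + 3/2) ^ 2"]
    by (simp add: norm_divide norm_power)
  finally show ?thesis by simp
qed

text \<open>The reciprocal is 1/4 (1 + 2/(z - 1/2)) (1 + 1/(z + 1/2)). With |z - 1/2| at least 1/4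
  and |z + 1/2| at least 1/2 the two factors are at most 1 + 8 = 9 and 1 + 2 = 3.\<close>

lemma inverse_mult_bound:
  assumes z: "z \<in> closed_strip" and far: "1/4 \<le> dist (1/2) z"
  shows "cmod (1 / strip_mult z) \<le> 27/4"
proof -
  note d = strip_denominators[OF z]
  have f: "1/4 \<le> cmod (z - 1/2)" using far by (simp add: dist_norm norm_minus_commute)
  then have ne: "z - 1/2 \<noteq> 0" by (metis norm_zero zero_less_divide_1_iff zero_less_numeral not_le)
  have shift: "z - 1/2 + 2 = z + 3/2" "z + 1/2 + 1 = z + 3/2" by simp_all
  have "1 / strip_mult z = 1/4 * ((z + 3/2) / (z - 1/2)) * ((z + 3/2) / (z + 1/2))"
    by (simp add: strip_mult_def power2_eq_square)
  also have "(z + 3/2) / (z - 1/2) = 1 + 2 / (z - 1/2)"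
    using add_divide_distrib[of "z - 1/2" 2 "z - 1/2"] by (simp only: divide_self[OF ne] shift)
  also have "(z + 3/2) / (z + 1/2) = 1 + 1 / (z + 1/2)"
    using add_divide_distrib[of "z + 1/2" 1 "z + 1/2"] by (simp only: divide_self[OF d(3)] shift)
  finally have "cmod (1 / strip_mult z) = 1/4 * cmod (1 + 2 / (z - 1/2)) * cmod (1 + 1 / (z + 1/2))"
    by (simp only: norm_mult) simp
  also have "\<dots> \<le> 1/4 * 9 * 3"
  proof (intro mult_mono)
    show "cmod (1 + 2 / (z - 1/2)) \<le> 9"
      using norm_triangle_ineq[of 1 "2 / (z - 1/2)"] f frac_le[of 2 2 "1/4" "cmod (z-1/2)"]
      by (simp add: norm_divide)
    show "cmod (1 + 1 / (z + 1/2)) \<le> 3"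
      using norm_triangle_ineq[of 1 "1 / (z + 1/2)"] d(1) frac_le[of 1 1 "1/2" "cmod (z+1/2)"]
      by (simp add: norm_divide)
  qed auto
  finally show ?thesis by simp
qed

text \<open>At z = 1/2 one has u = z + 3/2 = 2. There 12/u^2 - 16/u^3 = 3 - 2 = 1, and its
  derivative -24/u^3 + 48/u^4 = -3 + 3 = 0. The first formula is proved on the whole open strip so
  that it can be differentiated again.\<close>

lemma strip_mult_taylor: "strip_mult (1/2) = 0" "deriv strip_mult (1/2) = 1" "(deriv ^^ 2) strip_mult (1/2) = 0"
proof -
  show "strip_mult (1/2) = 0" by (simp add: strip_mult_def)
  let ?d = "\<lambda>z::complex. 12 / (z + 3/2)^2 - 16 / (z + 3/2)^3"
  have D1: "(strip_mult has_field_derivative ?d z) (at z)" if "z \<in> open_strip" for z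
  proof -
    have ne: "z + 3/2 \<noteq> 0" using strip_denominators that open_strip_subset by blast
    have "((\<lambda>u. 4 - 12 / u + 8 / u^2) has_field_derivative 12 / u^2 - 16 / u^3) (at u)"
      if "u \<noteq> 0" for u :: complex
      by (rule derivative_eq_intros refl | use that in \<open>simp; fail\<close>)+
        (use that in \<open>simp add: field_simps eval_nat_numeral\<close>)
    from DERIV_shift[THEN iffD1, OF this[OF ne]]
    have "((\<lambda>z. 4 - 12 / (z + 3/2) + 8 / (z + 3/2)^2) has_field_derivative ?d z) (at z)" .
    then show ?thesis
      by (rule has_field_derivative_transform_within_open[OF _ open_open_strip that])
        (use strip_mult_partial_fractions strip_denominators(4) open_strip_subset in auto)
  qed
  then have eq: "deriv strip_mult z = ?d z" if "z \<in> open_strip" for z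
    using that DERIV_imp_deriv by blast
  show "deriv strip_mult (1/2) = 1"
    using eq[OF half_in_open_strip] by (simp add: power2_eq_square power3_eq_cube)
  have "(?d has_field_derivative 0) (at (1/2))"
    by (rule derivative_eq_intros refl | simp add: eval_nat_numeral; fail)+
  then have "deriv ?d (1/2) = 0" by (rule DERIV_imp_deriv)
  moreover have "deriv (deriv strip_mult) (1/2) = deriv ?d (1/2)"
    using eventually_nhds_in_open[OF open_open_strip half_in_open_strip] eq
    by (intro deriv_cong_ev) (auto elim!: eventually_mono)
  ultimately show "(deriv ^^ 2) strip_mult (1/2) = 0" by (simp add: numeral_2_eq_2)
qed

section \<open>Taylor coefficients of products, and division by the multiplier\<close>

lemma Delta_mult:
  assumes F: "F \<in> calderon" and G: "G \<in> calderon"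
    and eq: "\<And>z n. z \<in> open_strip \<Longrightarrow> F z n = strip_mult z * G z n"
  shows "Delta 0 F = 0" "Delta 1 F = Delta 0 G" "Delta 2 F = Delta 1 G"
proof -
  \<comment> \<open>The Leibniz rule in each coordinate. For k = 2 it leaves 2 h' G' + h'' G at 1/2;
    the last term vanishes, and the 2 cancels against \<open>fact 2\<close> in
    \<open>Delta\<close>.\<close>
  have D: "(deriv ^^ k) (\<lambda>w. F w n) (1/2) = (\<Sum>i = 0..k. of_nat (k choose i) *
      (deriv ^^ i) strip_mult (1/2) * (deriv ^^ (k - i)) (\<lambda>w. G w n) (1/2))" for k n
  proof -
    have "(deriv ^^ k) (\<lambda>w. F w n) (1/2) = (deriv ^^ k) (\<lambda>w. strip_mult w * G w n) (1/2)"
      using eventually_nhds_in_open[OF open_open_strip half_in_open_strip] eq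
      by (intro higher_deriv_cong_ev) (auto elim!: eventually_mono)
    also have "\<dots> = (\<Sum>i = 0..k. of_nat (k choose i) *
      (deriv ^^ i) strip_mult (1/2) * (deriv ^^ (k - i)) (\<lambda>w. G w n) (1/2))"
      by (rule higher_deriv_mult[OF _ calderon_coordinate_holomorphic[OF G] open_open_strip
            half_in_open_strip])
        (rule holomorphic_on_subset[OF strip_mult_holomorphic open_strip_subset])
    finally show ?thesis .
  qed
  note c = Delta_coordinate[OF F] Delta_coordinate[OF G] D
  show "Delta 0 F = 0"
    unfolding fun_eq_iff c by (simp add: strip_mult_taylor)
  show "Delta 1 F = Delta 0 G"
    unfolding fun_eq_iff c using strip_mult_taylor by simp
  show "Delta 2 F = Delta 1 G"
    unfolding fun_eq_iff c using strip_mult_taylor by (simp add: numeral_2_eq_2)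
qed

lemma calderon_mult:
  assumes F: "F \<in> calderon"
  shows "(\<lambda>z n. strip_mult z * F z n) \<in> calderon"
proof (rule calderon_multiplier[OF F, where m = strip_mult and M = 24])
  show "(\<lambda>z. strip_mult z * F z n) holomorphic_on open_strip" for n
    by (intro holomorphic_on_mult calderon_coordinate_holomorphic[OF F]
        holomorphic_on_subset[OF strip_mult_holomorphic open_strip_subset])
  show "continuous_on (closed_strip - {1/2}) strip_mult"
    by (rule continuous_on_subset[OF holomorphic_on_imp_continuous_on[OF strip_mult_holomorphic]]) auto
qed (use strip_mult_bound in auto)

text \<open>The kernel condition makes every coordinate of \<open>F\<close> vanish at 1/2, where the
  multiplier has a simple zero, so each singularity is removable. The factorization is claimed on
  the strip only: the multiplier has another zero at -1/2.\<close>

lemma calderon_divide: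
  assumes F: "F \<in> ker_Delta 0"
  obtains G where "G \<in> calderon" "\<And>z n. z \<in> closed_strip \<Longrightarrow> F z n = strip_mult z * G z n"
proof -
  have Fc: "F \<in> calderon" and F0: "F (1/2) n = 0" for n
    using F by (auto simp: ker_Delta_def Delta_def fun_eq_iff)
  \<comment> \<open>The value at 1/2 is the limit given by l'Hopital's rule. The denominator equals
    1 but keeps the form in which the rule produces it.\<close>
  define G where "G z n = (if z = 1/2 then deriv (\<lambda>w. F w n) (1/2) / deriv strip_mult (1/2)
    else F z n / strip_mult z)" for z n
  have "G \<in> calderon"
  proof (rule calderon_multiplier[OF Fc, where m = "\<lambda>z. 1 / strip_mult z" and M = "27/4"])
    show "(\<lambda>z. G z n) holomorphic_on open_strip" for n
    proof (rule no_isolated_singularity'[where K = "{1/2}"])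
      have "((\<lambda>w. F w n / strip_mult w) \<longlongrightarrow> G (1/2) n) (at (1/2))"
      proof (rule lhopital_complex_simple)
        show "((\<lambda>w. F w n) has_field_derivative deriv (\<lambda>w. F w n) (1/2)) (at (1/2))"
          by (rule holomorphic_derivI[OF calderon_coordinate_holomorphic[OF Fc] open_open_strip
                half_in_open_strip])
        show "(strip_mult has_field_derivative deriv strip_mult (1/2)) (at (1/2))"
          by (rule holomorphic_derivI[OF holomorphic_on_subset[OF strip_mult_holomorphic open_strip_subset]
                open_open_strip half_in_open_strip])
      qed (use F0 strip_mult_taylor in \<open>simp_all add: G_def\<close>)
      moreover have "\<forall>\<^sub>F w in at (1/2). F w n / strip_mult w = G w n"
        using eventually_neq_at_within[of "1/2"] by eventually_elim (simp add: G_def)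
      ultimately have "((\<lambda>w. G w n) \<longlongrightarrow> G (1/2) n) (at (1/2))"
        by (rule Lim_transform_eventually)
      then show "((\<lambda>w. G w n) \<longlongrightarrow> G z n) (at z within open_strip)" if "z \<in> {1/2}" for z
        using that tendsto_within_subset by blast
      have "(\<lambda>z. F z n / strip_mult z) holomorphic_on open_strip - {1/2}"
        using open_strip_subset strip_mult_nonzero
        by (intro holomorphic_on_divide
            holomorphic_on_subset[OF calderon_coordinate_holomorphic[OF Fc]]
            holomorphic_on_subset[OF strip_mult_holomorphic]) auto
      then show "(\<lambda>z. G z n) holomorphic_on open_strip - {1/2}"
        by (rule holomorphic_transform) (simp add: G_def)
    qed (simp_all add: open_open_strip)
    show "continuous_on (closed_strip - {1/2}) (\<lambda>z. 1 / strip_mult z)"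
      by (intro continuous_intros
          continuous_on_subset[OF holomorphic_on_imp_continuous_on[OF strip_mult_holomorphic]])
        (use strip_mult_nonzero in auto)
  qed (use inverse_mult_bound in \<open>auto simp: G_def\<close>)
  moreover have "F z n = strip_mult z * G z n" if "z \<in> closed_strip" for z n
    by (cases "z = 1/2") (simp_all only: F0 strip_mult_taylor(1) G_def strip_mult_nonzero[OF that] if_True if_False
        mult_zero_left nonzero_mult_div_cancel_left times_divide_eq_right not_False_eq_True)
  ultimately show ?thesis using that by blast
qed

lemma Delta_pair_image: "Delta_pair 2 1 ` ker_Delta 0 = Delta_pair 1 0 ` calderon"
proof
  show "Delta_pair 2 1 ` ker_Delta 0 \<subseteq> Delta_pair 1 0 ` calderon"
  proof
    fix p assume "p \<in> Delta_pair 2 1 ` ker_Delta 0"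
    then obtain F where F: "F \<in> ker_Delta 0" "p = Delta_pair 2 1 F" by blast
    obtain G where G: "G \<in> calderon" "\<And>z n. z \<in> closed_strip \<Longrightarrow> F z n = strip_mult z * G z n"
      using calderon_divide[OF F(1)] by blast
    have "F \<in> calderon" using F(1) by (simp add: ker_Delta_def)
    then have "p = Delta_pair 1 0 G"
      using Delta_mult[OF _ G(1)] G(2) open_strip_subset
      by (simp add: F(2) Delta_pair_def subset_iff)
    then show "p \<in> Delta_pair 1 0 ` calderon" using G(1) by blast
  qed
  show "Delta_pair 1 0 ` calderon \<subseteq> Delta_pair 2 1 ` ker_Delta 0"
  proof
    fix p assume "p \<in> Delta_pair 1 0 ` calderon"
    then obtain G where G: "G \<in> calderon" "p = Delta_pair 1 0 G" by blast
    let ?F = "\<lambda>z n. strip_mult z * G z n"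
    note D = Delta_mult[OF calderon_mult[OF G(1)] G(1) refl]
    have "?F \<in> ker_Delta 0" "p = Delta_pair 2 1 ?F"
      using D calderon_mult[OF G(1)] G(2) by (simp_all add: ker_Delta_def Delta_pair_def)
    then show "p \<in> Delta_pair 2 1 ` ker_Delta 0" by blast
  qed
qed

text \<open>The other equalities are read off from the pairs: project to the second component, or keep
  the pairs with one component zero.\<close>

theorem proposition5p2:
  "(Delta 2 ` (ker_Delta 1 \<inter> ker_Delta 0) = Delta 1 ` ker_Delta 0 \<and>
    Delta 1 ` ker_Delta 0 = Delta 0 ` calderon) \<and>
   Delta_pair 2 1 ` ker_Delta 0 = Delta_pair 1 0 ` calderon \<and>
   Delta 1 ` (ker_Delta 0 \<inter> ker_Delta 2) = Delta 0 ` ker_Delta 1"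
proof -
  have ker: "ker_Delta k = {F \<in> calderon. Delta k F = 0}" for k
    by (rule ker_Delta_def)
  \<comment> \<open>Stated for single pairs so that a component can be fixed: y = 0 puts G into
    \<open>ker_Delta 0\<close>, x = 0 puts it into \<open>ker_Delta 1\<close>, and leaving x open
    gives the projection to the second component.\<close>
  have iff: "(\<exists>F\<in>ker_Delta 0. Delta 2 F = x \<and> Delta 1 F = y) \<longleftrightarrow>
      (\<exists>G\<in>calderon. Delta 1 G = x \<and> Delta 0 G = y)" for x y
  proof -
    have "(x, y) \<in> Delta_pair 2 1 ` ker_Delta 0 \<longleftrightarrow> (x, y) \<in> Delta_pair 1 0 ` calderon"
      by (simp only: Delta_pair_image)
    then show ?thesis by (auto simp: Delta_pair_def image_iff)
  qed
  have "Delta 2 ` (ker_Delta 1 \<inter> ker_Delta 0) = Delta 1 ` ker_Delta 0"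
  proof (rule set_eqI)
    fix x
    show "x \<in> Delta 2 ` (ker_Delta 1 \<inter> ker_Delta 0) \<longleftrightarrow> x \<in> Delta 1 ` ker_Delta 0"
      using iff[of x 0] unfolding image_iff ker Int_iff Bex_def mem_Collect_eq by metis
  qed
  moreover have "Delta 1 ` ker_Delta 0 = Delta 0 ` calderon"
  proof (rule set_eqI)
    fix x
    show "x \<in> Delta 1 ` ker_Delta 0 \<longleftrightarrow> x \<in> Delta 0 ` calderon"
      using iff[of _ x] unfolding image_iff Bex_def by metis
  qed
  moreover have "Delta 1 ` (ker_Delta 0 \<inter> ker_Delta 2) = Delta 0 ` ker_Delta 1"
  proof (rule set_eqI)
    fix x
    show "x \<in> Delta 1 ` (ker_Delta 0 \<inter> ker_Delta 2) \<longleftrightarrow> x \<in> Delta 0 ` ker_Delta 1"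
      using iff[of 0 x] unfolding image_iff ker Int_iff Bex_def mem_Collect_eq by metis
  qed
  ultimately show ?thesis using Delta_pair_image by blast
qed

end
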